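(* Let $n_L$ be fixed and consider a sequence of asymmetric hub models with $n\to\infty$, $T\to\infty$, satisfying the standing assumption on $\rho$ in the context. Let $d,v\in(0,1]$ be constants such that: (i) for each $i=1,\dots,n_L$ there exists a set $V_i\subset\{1,\dots,n\}$ with $|V_i|\ge vn/n_L$ and $A_{ij}-A_{i'j}\ge d$ for all $j\in V_i$ and all $i'\in\{1,\dots,n_L\}$, $i'\ne i$; (ii) $A_{ii'}$ is bounded away from $1$ (by a constant) for all $i,i'\in\{1,\dots,n_L\}$, $i\ne i'$. Then $$T_e/T=o_p(1)\quad\text{as } n\to\infty,\ T\to\infty.$$
   Context: Asymmetric hub model: nodes $1,\dots,n$; leaders (possible hubs) $1,\dots,n_L$ with $n_L\le n$; parameters $\rho=(\rho_1,\dots,\rho_{n_L})$ with $\rho_i\ge0$, $\sum_i\rho_i=1$, and $A\in[0,1]^{n_L\times n}$ with $A_{ii}=1$ for $i\le n_L$. Independently for $t=1,\dots,T$, a latent hub $z_*^{(t)}\in\{1,\dots,n_L\}$ is drawn with $\mathbb P(z_*^{(t)}=i)=\rho_i$, and given $z_*^{(t)}=i$ the variables $G_j^{(t)}\in\{0,1\}$, $j=1,\dots,n$, are independent with $\mathbb P(G_j^{(t)}=1\mid z_*^{(t)}=i)=A_{ij}$. Only $G$ is observed. Profile likelihood estimator: for an assignment $z=(z^{(1)},\dots,z^{(T)})\in\{1,\dots,n_L\}^T$ let $t_i=\sum_t1(z^{(t)}=i)$, $\hat A^z_{ij}=\frac{1}{t_i}\sum_tG_j^{(t)}1(z^{(t)}=i)$,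 and $$L_G(z)=\sum_{t=1}^T\sum_{j=1}^n G_j^{(t)}\log\hat A^z_{z^{(t)},j}+(1-G_j^{(t)})\log(1-\hat A^z_{z^{(t)},j}),\qquad 0\log0=0.$$ An assignment is feasible if $G^{(t)}_{z^{(t)}}=1$ for every $t$ (the assigned hub appears in its group). $\hat z$ is a maximizer of $L_G(z)$ over feasible assignments. $T_e=\sum_t1(z_*^{(t)}\ne\hat z^{(t)})$ is the number of mislabeled groups. Asymptotics: $n,T,\rho,A$ vary along a sequence while $n_L,d,v$ are fixed; $o_p(1)$ is along this sequence, and "constant" means independent of the sequence index. Standing assumption: $\min_i\rho_i=c_{\min*}/n_L$ and $\max_i\rho_i=c_{\max*}/n_L$ with positive constants $c_{\min*},c_{\max*}$. *)

theory Defs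
  imports "HOL-Probability.Probability"
begin

text \<open>
  Nodes are \<open>1, \<dots>, n\<close>, leaders \<open>1, \<dots>, n\<^sub>L\<close>, groups \<open>1, \<dots>, T\<close>; \<open>zs t\<close> is the latent hub of
  group \<open>t\<close>, and \<open>G t j \<omega>\<close> says that node \<open>j\<close> appears in group \<open>t\<close>.  Values of these families at
  indices outside these ranges are irrelevant.

  The law of \<open>G t\<close> given \<open>zs t = i\<close> is the library's \<open>uniform_measure\<close>, i.e. the measure
  \<open>B \<mapsto> P (B \<inter> {zs t = i}) / P {zs t = i}\<close>.  It is a probability measure only if
  \<open>P {zs t = i} > 0\<close>, hence the premise \<open>\<rho> i > 0\<close> in the last two axioms.
\<close>

locale asymmetric_hub_model = prob_space M
  for M :: "'a measure" +
  fixes nL n T :: nat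
    and \<rho> :: "nat \<Rightarrow> real"
    and A :: "nat \<Rightarrow> nat \<Rightarrow> real"
    and zs :: "nat \<Rightarrow> 'a \<Rightarrow> nat"
    and G :: "nat \<Rightarrow> nat \<Rightarrow> 'a \<Rightarrow> bool"
  assumes leaders_le_nodes: "nL \<le> n"
    and rho_nonneg: "\<And>i. i \<in> {1..nL} \<Longrightarrow> 0 \<le> \<rho> i"
    and rho_sum: "(\<Sum>i\<in>{1..nL}. \<rho> i) = 1"
    and A_range: "\<And>i j. i \<in> {1..nL} \<Longrightarrow> j \<in> {1..n} \<Longrightarrow> A i j \<in> {0..1}"
    and A_diag: "\<And>i. i \<in> {1..nL} \<Longrightarrow> A i i = 1"
    and groups_indep:
      "indep_vars (\<lambda>_. count_space UNIV \<Otimes>\<^sub>M (\<Pi>\<^sub>M j\<in>{1..n}. count_space UNIV))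
        (\<lambda>t \<omega>. (zs t \<omega>, \<lambda>j\<in>{1..n}. G t j \<omega>)) {1..T}"
    and hub_law: "\<And>t i. t \<in> {1..T} \<Longrightarrow> i \<in> {1..nL} \<Longrightarrow> \<P>(\<omega> in M. zs t \<omega> = i) = \<rho> i"
    and nodes_cond_indep:
      "\<And>t i. t \<in> {1..T} \<Longrightarrow> i \<in> {1..nL} \<Longrightarrow> \<rho> i > 0 \<Longrightarrow>
        prob_space.indep_vars (uniform_measure M {\<omega> \<in> space M. zs t \<omega> = i})
          (\<lambda>_. count_space UNIV) (G t) {1..n}"
    and node_cond_law:
      "\<And>t i j. t \<in> {1..T} \<Longrightarrow> i \<in> {1..nL} \<Longrightarrow> \<rho> i > 0 \<Longrightarrow> j \<in> {1..n} \<Longrightarrow>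
        \<P>(\<omega> in uniform_measure M {\<omega> \<in> space M. zs t \<omega> = i}. G t j \<omega>) = A i j"

definition group_count :: "nat \<Rightarrow> (nat \<Rightarrow> nat) \<Rightarrow> nat \<Rightarrow> nat" where
  "group_count T z i = (\<Sum>t\<in>{1..T}. of_bool (z t = i))"

definition A_hat :: "nat \<Rightarrow> (nat \<Rightarrow> nat \<Rightarrow> bool) \<Rightarrow> (nat \<Rightarrow> nat) \<Rightarrow> nat \<Rightarrow> nat \<Rightarrow> real" where
  "A_hat T g z i j =
    1 / real (group_count T z i) * (\<Sum>t\<in>{1..T}. of_bool (g t j) * of_bool (z t = i))"

text \<open>The convention \<open>0 log 0 = 0\<close> needs no case distinction, since \<open>ln 0 = 0\<close> in the library, and
  a factor \<open>1\<close> never meets \<open>ln 0\<close> below: \<open>g t j\<close> implies \<open>A_hat T g z (z t) j > 0\<close> for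
  \<open>t \<in> {1..T}\<close>, and dually.\<close>

definition profile_log_lik ::
    "nat \<Rightarrow> nat \<Rightarrow> (nat \<Rightarrow> nat \<Rightarrow> bool) \<Rightarrow> (nat \<Rightarrow> nat) \<Rightarrow> real" where
  "profile_log_lik n T g z = (\<Sum>t\<in>{1..T}. \<Sum>j\<in>{1..n}.
     of_bool (g t j) * ln (A_hat T g z (z t) j)
     + (1 - of_bool (g t j)) * ln (1 - A_hat T g z (z t) j))"

definition feasible :: "nat \<Rightarrow> nat \<Rightarrow> (nat \<Rightarrow> nat \<Rightarrow> bool) \<Rightarrow> (nat \<Rightarrow> nat) \<Rightarrow> bool" where
  "feasible nL T g z \<longleftrightarrow> (\<forall>t\<in>{1..T}. z t \<in> {1..nL} \<and> g t (z t))"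

definition profile_mle ::
    "nat \<Rightarrow> nat \<Rightarrow> nat \<Rightarrow> (nat \<Rightarrow> nat \<Rightarrow> bool) \<Rightarrow> (nat \<Rightarrow> nat) \<Rightarrow> bool" where
  "profile_mle nL n T g z \<longleftrightarrow> is_arg_max (profile_log_lik n T g) (feasible nL T g) z"

definition mislabeled :: "nat \<Rightarrow> (nat \<Rightarrow> nat) \<Rightarrow> (nat \<Rightarrow> nat) \<Rightarrow> nat" where
  "mislabeled T z z' = (\<Sum>t\<in>{1..T}. of_bool (z t \<noteq> z' t))"

text \<open>Convergence to \<open>0\<close> in probability, each \<open>X m\<close> living on its own space \<open>M m\<close>.\<close>

definition small_o_p_1 :: "(nat \<Rightarrow> 'a measure) \<Rightarrow> (nat \<Rightarrow> 'a \<Rightarrow> real) \<Rightarrow> bool" where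
  "small_o_p_1 M X \<longleftrightarrow>
    (\<forall>\<epsilon>>0. (\<lambda>m. \<P>(\<omega> in M m. \<bar>X m \<omega>\<bar> > \<epsilon>)) \<longlonglongrightarrow> 0)"

end

theory Submission
  imports Defs
begin

text \<open>
  The logarithms are avoided by exponentiating: \<open>exp (profile_log_lik n T g z)\<close> is the likelihood of
  \<open>(z, P)\<close> with \<open>P\<close> the empirical frequencies, and these maximize the likelihood for given \<open>z\<close>.
  Hence the likelihood at the estimate is at least the one at the true labels and the true \<open>A\<close>.
  For a fixed rival \<open>(z, P)\<close>, whose rows are at total squared distance \<open>\<tau>\<close> from the true ones, this
  has probability at most \<open>exp (- \<tau> / 4)\<close> by the Hellinger affinity.  There are at most
  \<open>nL ^ T\<close> assignments and \<open>(T + 1) ^ (2 * nL * n)\<close> frequency matrices, that is \<open>exp (o(n T))\<close>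
  rivals.  On the other hand, if more than \<open>\<eta> T\<close> groups are mislabeled, then the
  separation of the rows of \<open>A\<close> and feasibility give \<open>\<tau>\<close> of order \<open>n T\<close>, provided that each leader
  \<open>i\<close> is absent from more than \<open>\<eta> T\<close> of the groups of every other leader, which Hoeffding's
  inequality ensures.
\<close>

section \<open>Likelihoods and affinities\<close>

definition bern_mass :: "real \<Rightarrow> bool \<Rightarrow> real" where
  "bern_mass p b = (if b then p else 1 - p)"

text \<open>The likelihood of the node variables given the labels; like the profile likelihood, it
  has no factor for the probabilities of the labels themselves.\<close>

definition hub_lik ::
    "nat \<Rightarrow> nat \<Rightarrow> (nat \<Rightarrow> nat \<Rightarrow> real) \<Rightarrow> (nat \<Rightarrow> nat) \<Rightarrow> (nat \<Rightarrow> nat \<Rightarrow> bool) \<Rightarrow> real" where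
  "hub_lik n T P z g = (\<Prod>t\<in>{1..T}. \<Prod>j\<in>{1..n}. bern_mass (P (z t) j) (g t j))"

text \<open>Each matrix is read through its own assignment: rows are compared group by group, and a
  label need not mean the same in \<open>A\<close> and in \<open>P\<close>.\<close>

definition sq_gap ::
    "nat \<Rightarrow> nat \<Rightarrow> (nat \<Rightarrow> nat \<Rightarrow> real) \<Rightarrow> (nat \<Rightarrow> nat \<Rightarrow> real) \<Rightarrow> (nat \<Rightarrow> nat) \<Rightarrow> (nat \<Rightarrow> nat) \<Rightarrow> real" where
  "sq_gap n T A P s z = (\<Sum>t\<in>{1..T}. \<Sum>j\<in>{1..n}. (A (s t) j - P (z t) j)\<^sup>2)"

lemma bern_mass_nonneg: "p \<in> {0..1} \<Longrightarrow> 0 \<le> bern_mass p b"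
  by (simp add: bern_mass_def)

lemma hub_lik_nonneg:
  assumes "\<And>t j. t \<in> {1..T} \<Longrightarrow> j \<in> {1..n} \<Longrightarrow> P (z t) j \<in> {0..1}"
  shows "0 \<le> hub_lik n T P z g"
  unfolding hub_lik_def using assms by (intro prod_nonneg bern_mass_nonneg) auto

lemma hub_lik_cong:
  assumes "\<And>t j. t \<in> {1..T} \<Longrightarrow> j \<in> {1..n} \<Longrightarrow> P (z t) j = P' (z' t) j"
    and "\<And>t j. t \<in> {1..T} \<Longrightarrow> j \<in> {1..n} \<Longrightarrow> g t j = g' t j"
  shows "hub_lik n T P z g = hub_lik n T P' z' g'"
  unfolding hub_lik_def using assms by (intro prod.cong refl) auto

lemma sq_gap_cong:
  assumes "\<And>t j. t \<in> {1..T} \<Longrightarrow> j \<in> {1..n} \<Longrightarrow> A (s t) j = A' (s' t) j"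
    and "\<And>t j. t \<in> {1..T} \<Longrightarrow> j \<in> {1..n} \<Longrightarrow> P (z t) j = P' (z' t) j"
  shows "sq_gap n T A P s z = sq_gap n T A' P' s' z'"
  unfolding sq_gap_def using assms by (intro sum.cong refl) auto

text \<open>In x - y = (sqrt x - sqrt y) (sqrt x + sqrt y) the last factor is at most 2, so each of
  the two squares in the Hellinger distance is at least (p - q)^2 / 4. The affinity is 1 minus half
  the sum of these squares.\<close>

lemma bern_affinity_le:
  assumes p: "p \<in> {0..1}" and q: "q \<in> {0..1}"
  shows "(\<Sum>b\<in>UNIV. sqrt (bern_mass p b * bern_mass q b)) \<le> exp (- (p - q)\<^sup>2 / 4)"
proof -
  have sqrt_diff: "(x - y)\<^sup>2 / 4 \<le> (sqrt x - sqrt y)\<^sup>2" if "x \<in> {0..1}" "y \<in> {0..1}" for x y :: real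
  proof -
    have "sqrt x \<le> 1" "sqrt y \<le> 1" "0 \<le> sqrt x" "0 \<le> sqrt y" using that by auto
    hence "sqrt x + sqrt y \<le> 2" "0 \<le> sqrt x + sqrt y" by linarith+
    hence "(sqrt x + sqrt y)\<^sup>2 \<le> 2\<^sup>2" by (intro power_mono)
    moreover have "x - y = (sqrt x - sqrt y) * (sqrt x + sqrt y)"
      using that by (simp add: algebra_simps)
    ultimately have "(x - y)\<^sup>2 \<le> (sqrt x - sqrt y)\<^sup>2 * 4"
      by (simp only: power_mult_distrib) (intro mult_left_mono, auto)
    thus ?thesis by simp
  qed
  have "(\<Sum>b\<in>UNIV. sqrt (bern_mass p b * bern_mass q b)) =
      sqrt p * sqrt q + sqrt (1 - p) * sqrt (1 - q)"
    by (simp add: UNIV_bool bern_mass_def real_sqrt_mult)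
  also have "\<dots> = 1 - ((sqrt p - sqrt q)\<^sup>2 + (sqrt (1 - p) - sqrt (1 - q))\<^sup>2) / 2"
    using p q by (simp add: power2_diff field_simps)
  also have "\<dots> \<le> 1 - (p - q)\<^sup>2 / 4"
    using sqrt_diff[of p q] sqrt_diff[of "1 - p" "1 - q"] p q by (simp add: power2_commute)
  also have "\<dots> \<le> exp (- (p - q)\<^sup>2 / 4)"
    using exp_ge_add_one_self[of "- (p - q)\<^sup>2 / 4"] by simp
  finally show ?thesis .
qed

text \<open>The affinity of product laws is the product of the affinities: the sum over all data
  arrays factors first over groups, then over nodes, and \<open>bern_affinity_le\<close> bounds each
  factor.\<close>

lemma hub_lik_affinity_le:
  assumes A: "\<And>t j. t \<in> {1..T} \<Longrightarrow> j \<in> {1..n} \<Longrightarrow> A (s t) j \<in> {0..1}"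
    and P: "\<And>t j. t \<in> {1..T} \<Longrightarrow> j \<in> {1..n} \<Longrightarrow> P (z t) j \<in> {0..1}"
  shows "(\<Sum>g\<in>{1..T} \<rightarrow>\<^sub>E {1..n} \<rightarrow>\<^sub>E UNIV. sqrt (hub_lik n T A s g * hub_lik n T P z g))
    \<le> exp (- sq_gap n T A P s z / 4)"
proof -
  define h where "h t j b = sqrt (bern_mass (A (s t) j) b * bern_mass (P (z t) j) b)" for t j b
  have sqrt_prod: "sqrt (prod f I) = (\<Prod>i\<in>I. sqrt (f i))" for f and I :: "nat set"
    by (induction I rule: infinite_finite_induct) (simp_all add: real_sqrt_mult)
  have "(\<Sum>g\<in>{1..T} \<rightarrow>\<^sub>E {1..n} \<rightarrow>\<^sub>E UNIV. sqrt (hub_lik n T A s g * hub_lik n T P z g))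
      = (\<Sum>g\<in>{1..T} \<rightarrow>\<^sub>E {1..n} \<rightarrow>\<^sub>E UNIV. \<Prod>t\<in>{1..T}. \<Prod>j\<in>{1..n}. h t j (g t j))"
    unfolding hub_lik_def h_def prod.distrib[symmetric] by (simp only: sqrt_prod)
  also have "\<dots> = (\<Prod>t\<in>{1..T}. \<Sum>r\<in>{1..n} \<rightarrow>\<^sub>E UNIV. \<Prod>j\<in>{1..n}. h t j (r j))"
    by (subst prod_sum_PiE) (auto intro!: finite_PiE)
  also have "\<dots> = (\<Prod>t\<in>{1..T}. \<Prod>j\<in>{1..n}. \<Sum>b\<in>UNIV. h t j b)"
    by (subst prod_sum_PiE) auto
  also have "\<dots> \<le> (\<Prod>t\<in>{1..T}. \<Prod>j\<in>{1..n}. exp (- (A (s t) j - P (z t) j)\<^sup>2 / 4))"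
    unfolding h_def using A P
    by (intro prod_mono conjI prod_nonneg sum_nonneg bern_affinity_le real_sqrt_ge_zero
        mult_nonneg_nonneg bern_mass_nonneg) auto
  also have "\<dots> = exp (- sq_gap n T A P s z / 4)"
    unfolding sq_gap_def by (simp add: exp_sum[symmetric] sum_negf sum_divide_distrib)
  finally show ?thesis .
qed

section \<open>Empirical frequencies and the profile likelihood\<close>

lemma group_count_eq_card: "group_count T z i = card {t\<in>{1..T}. z t = i}"
  unfolding group_count_def by (simp add: Int_def conj_commute)

lemma A_hat_eq_card:
  "A_hat T g z i j = real (card {t\<in>{1..T}. z t = i \<and> g t j}) / real (card {t\<in>{1..T}. z t = i})"
proof -
  have "(\<Sum>t\<in>{1..T}. of_bool (g t j) * of_bool (z t = i) :: real)
      = (\<Sum>t\<in>{1..T}. of_bool (z t = i \<and> g t j))"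
    by (intro sum.cong) auto
  also have "\<dots> = real (card {t\<in>{1..T}. z t = i \<and> g t j})"
    by (simp add: Int_def conj_commute)
  finally show ?thesis by (simp add: A_hat_def group_count_eq_card)
qed

lemma one_minus_A_hat_eq_card:
  assumes "{t\<in>{1..T}. z t = i} \<noteq> {}"
  shows "1 - A_hat T g z i j =
    real (card {t\<in>{1..T}. z t = i \<and> \<not> g t j}) / real (card {t\<in>{1..T}. z t = i})"
proof -
  have "card {t\<in>{1..T}. z t = i} =
      card ({t\<in>{1..T}. z t = i \<and> g t j} \<union> {t\<in>{1..T}. z t = i \<and> \<not> g t j})"
    by (intro arg_cong[where f = card]) auto
  also have "\<dots> = card {t\<in>{1..T}. z t = i \<and> g t j} + card {t\<in>{1..T}. z t = i \<and> \<not> g t j}"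
    by (intro card_Un_disjoint) auto
  finally have "card {t\<in>{1..T}. z t = i} = \<dots>" .
  moreover have "card {t\<in>{1..T}. z t = i} > 0" using assms by (simp add: card_gt_0_iff)
  moreover have "1 - real a / real c = real b / real c" if "c = a + b" "0 < c" for a b c :: nat
    using that by (simp add: field_simps del: of_nat_add)
  ultimately show ?thesis unfolding A_hat_eq_card by blast
qed

text \<open>Group \<open>t\<close> is itself counted in the frequency of its own outcome. This keeps
  the logarithms and the later quotients away from 0.\<close>

lemma bern_mass_A_hat_pos:
  assumes "t \<in> {1..T}"
  shows "0 < bern_mass (A_hat T g z (z t) j) (g t j)"
proof -
  have ne: "{t'\<in>{1..T}. z t' = z t} \<noteq> {}" using assms by auto
  hence "card {t'\<in>{1..T}. z t' = z t} > 0" by (simp add: card_gt_0_iff)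
  moreover have "g t j \<Longrightarrow> card {t'\<in>{1..T}. z t' = z t \<and> g t' j} > 0"
    "\<not> g t j \<Longrightarrow> card {t'\<in>{1..T}. z t' = z t \<and> \<not> g t' j} > 0"
    using assms by (auto simp: card_gt_0_iff)
  ultimately show ?thesis
    using one_minus_A_hat_eq_card[OF ne, of g j]
    by (auto simp: bern_mass_def A_hat_eq_card[of T g z "z t" j])
qed

lemma exp_profile_log_lik:
  "exp (profile_log_lik n T g z) = hub_lik n T (A_hat T g z) z g"
proof -
  have "exp (of_bool (g t j) * ln (A_hat T g z (z t) j)
      + (1 - of_bool (g t j)) * ln (1 - A_hat T g z (z t) j))
      = bern_mass (A_hat T g z (z t) j) (g t j)" if "t \<in> {1..T}" for t j
    using bern_mass_A_hat_pos[OF that, of g z j] by (auto simp: bern_mass_def)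
  thus ?thesis
    unfolding profile_log_lik_def hub_lik_def by (simp add: exp_sum)
qed

text \<open>Gibbs' inequality in product form: \<open>x \<le> exp (x - 1)\<close> is applied to each ratio of the two
  masses, and the ratios of a group of size \<open>c\<close> sum to at most \<open>c\<close>.\<close>

lemma hub_lik_le_hub_lik_A_hat:
  assumes Q: "\<And>t j. t \<in> {1..T} \<Longrightarrow> j \<in> {1..n} \<Longrightarrow> Q (z t) j \<in> {0..1}"
  shows "hub_lik n T Q z g \<le> hub_lik n T (A_hat T g z) z g"
proof -
  define r where "r t j = bern_mass (Q (z t) j) (g t j) / bern_mass (A_hat T g z (z t) j) (g t j)" for t j
  have r_nonneg: "0 \<le> r t j" if "t \<in> {1..T}" "j \<in> {1..n}" for t j
    unfolding r_def using bern_mass_A_hat_pos[OF that(1), of g z j] bern_mass_nonneg[OF Q[OF that]]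
    by simp
  \<comment> \<open>An outcome that never occurs among the groups of a label has k = 0 and
    contributes 0; otherwise k cancels against the frequency and the group size c remains.\<close>
  have ratio_le: "real k * (x / (real k / c)) \<le> x * c" if "0 \<le> x" "0 \<le> c" for k x c
    using that by (cases "k = 0") auto
  have group: "(\<Sum>t\<in>{t\<in>{1..T}. z t = i}. r t j) \<le> real (card {t\<in>{1..T}. z t = i})"
    if i: "i \<in> z ` {1..T}" and j: "j \<in> {1..n}" for i j
  proof -
    let ?c = "card {t\<in>{1..T}. z t = i}"
    let ?p = "card {t\<in>{1..T}. z t = i \<and> g t j}" and ?q = "card {t\<in>{1..T}. z t = i \<and> \<not> g t j}"
    have ne: "{t\<in>{1..T}. z t = i} \<noteq> {}" and q01: "Q i j \<in> {0..1}"
      using i j Q by auto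
    have "(\<Sum>t\<in>{t\<in>{1..T}. z t = i}. r t j)
        = (\<Sum>t\<in>{t\<in>{1..T}. z t = i \<and> g t j} \<union> {t\<in>{1..T}. z t = i \<and> \<not> g t j}. r t j)"
      by (intro sum.cong) auto
    also have "\<dots> = (\<Sum>t\<in>{t\<in>{1..T}. z t = i \<and> g t j}. r t j)
        + (\<Sum>t\<in>{t\<in>{1..T}. z t = i \<and> \<not> g t j}. r t j)"
      by (intro sum.union_disjoint) auto
    finally have split: "(\<Sum>t\<in>{t\<in>{1..T}. z t = i}. r t j) = \<dots>" .
    have "(\<Sum>t\<in>{t\<in>{1..T}. z t = i \<and> g t j}. r t j) = real ?p * (Q i j / (real ?p / real ?c))"
      by (simp add: r_def bern_mass_def A_hat_eq_card)
    also have "\<dots> \<le> Q i j * real ?c"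
      using q01 by (intro ratio_le) auto
    finally have le1: "(\<Sum>t\<in>{t\<in>{1..T}. z t = i \<and> g t j}. r t j) \<le> Q i j * real ?c" .
    have "(\<Sum>t\<in>{t\<in>{1..T}. z t = i \<and> \<not> g t j}. r t j)
        = real ?q * ((1 - Q i j) / (real ?q / real ?c))"
      using one_minus_A_hat_eq_card[OF ne, of g j] by (simp add: r_def bern_mass_def)
    also have "\<dots> \<le> (1 - Q i j) * real ?c"
      using q01 by (intro ratio_le) auto
    finally have le2: "(\<Sum>t\<in>{t\<in>{1..T}. z t = i \<and> \<not> g t j}. r t j) \<le> (1 - Q i j) * real ?c" .
    show ?thesis using split le1 le2 by (simp add: algebra_simps)
  qed
  have sum_r: "(\<Sum>t\<in>{1..T}. r t j) \<le> real T" if j: "j \<in> {1..n}" for j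
  proof -
    have "(\<Sum>t\<in>{1..T}. r t j) = (\<Sum>i\<in>z ` {1..T}. \<Sum>t\<in>{t\<in>{1..T}. z t = i}. r t j)"
      by (rule sum.group[symmetric]) auto
    also have "\<dots> \<le> (\<Sum>i\<in>z ` {1..T}. real (card {t\<in>{1..T}. z t = i}))"
      by (intro sum_mono group j)
    also have "\<dots> = (\<Sum>i\<in>z ` {1..T}. \<Sum>t\<in>{t\<in>{1..T}. z t = i}. 1)" by simp
    also have "\<dots> = (\<Sum>t\<in>{1..T}. 1)" by (rule sum.group) auto
    finally show ?thesis by simp
  qed
  have "hub_lik n T Q z g = (\<Prod>j\<in>{1..n}. \<Prod>t\<in>{1..T}. r t j) * hub_lik n T (A_hat T g z) z g"
  proof -
    have "hub_lik n T Q z g =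
        (\<Prod>t\<in>{1..T}. \<Prod>j\<in>{1..n}. r t j * bern_mass (A_hat T g z (z t) j) (g t j))"
      unfolding hub_lik_def r_def
    proof (intro prod.cong refl)
      fix t j assume "t \<in> {1..T}"
      from bern_mass_A_hat_pos[OF this, of g z j]
      show "bern_mass (Q (z t) j) (g t j) = bern_mass (Q (z t) j) (g t j) /
        bern_mass (A_hat T g z (z t) j) (g t j) * bern_mass (A_hat T g z (z t) j) (g t j)" by simp
    qed
    also have "\<dots> = (\<Prod>t\<in>{1..T}. \<Prod>j\<in>{1..n}. r t j) * hub_lik n T (A_hat T g z) z g"
      by (simp add: hub_lik_def prod.distrib)
    \<comment> \<open>With the nodes outermost, each inner product runs over all groups, the range
      over which \<open>sum_r\<close> bounds the sum of the ratios.\<close>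
    also have "(\<Prod>t\<in>{1..T}. \<Prod>j\<in>{1..n}. r t j) = (\<Prod>j\<in>{1..n}. \<Prod>t\<in>{1..T}. r t j)"
      by (rule prod.swap)
    finally show ?thesis .
  qed
  also have "\<dots> \<le> 1 * hub_lik n T (A_hat T g z) z g"
  proof (rule mult_right_mono)
    show "(\<Prod>j\<in>{1..n}. \<Prod>t\<in>{1..T}. r t j) \<le> 1"
    proof (rule prod_le_1)
      fix j assume j: "j \<in> {1..n}"
      have "(\<Prod>t\<in>{1..T}. r t j) \<le> (\<Prod>t\<in>{1..T}. exp (r t j - 1))"
        using r_nonneg[OF _ j] exp_ge_add_one_self[of "r t j - 1" for t]
        by (intro prod_mono conjI) (auto simp: add.commute)
      also have "\<dots> = exp ((\<Sum>t\<in>{1..T}. r t j) - real T)"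
        by (simp add: exp_sum[symmetric] sum_subtractf)
      also have "\<dots> \<le> 1" using sum_r[OF j] by simp
      finally show "0 \<le> (\<Prod>t\<in>{1..T}. r t j) \<and> (\<Prod>t\<in>{1..T}. r t j) \<le> 1"
        using r_nonneg[OF _ j] by (auto intro!: prod_nonneg)
    qed
  qed (simp add: exp_profile_log_lik[symmetric])
  finally show ?thesis by simp
qed

section \<open>Separation of mislabeled assignments\<close>

definition frac_grid :: "nat \<Rightarrow> real set" where
  "frac_grid T = (\<lambda>(k, l). real (min k l) / real l) ` ({..T} \<times> {..T})"

lemma finite_frac_grid: "finite (frac_grid T)"
  by (simp add: frac_grid_def)

lemma card_frac_grid: "card (frac_grid T) \<le> (T + 1)\<^sup>2"
  unfolding frac_grid_def by (rule order.trans[OF card_image_le]) (auto simp: power2_eq_square)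

lemma frac_grid_range: "x \<in> frac_grid T \<Longrightarrow> x \<in> {0..1}"
  by (auto simp: frac_grid_def divide_le_eq)

lemma A_hat_in_frac_grid: "A_hat T g z i j \<in> frac_grid T"
proof -
  let ?k = "card {t\<in>{1..T}. z t = i \<and> g t j}" and ?l = "card {t\<in>{1..T}. z t = i}"
  have "?k \<le> ?l" by (intro card_mono) auto
  moreover have "?l \<le> card {1..T}" by (intro card_mono) auto
  ultimately show ?thesis
    unfolding frac_grid_def A_hat_eq_card
    by (intro image_eqI[where x = "(?k, ?l)"]) (auto simp: min_def)
qed

text \<open>A row of \<open>P\<close> can be close to at most one row of \<open>A\<close>, which defines a map \<open>\<kappa>\<close> of labels; if
  \<open>s\<close> were almost equal to \<open>\<kappa> \<circ> z\<close>, then \<open>\<kappa>\<close> would be a permutation, and feasibility would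
  force it to be the identity.\<close>

lemma sq_gap_ge_of_mislabeled:
  assumes sep: "\<And>k k'. k \<in> {1..nL} \<Longrightarrow> k' \<in> {1..nL} \<Longrightarrow> k \<noteq> k' \<Longrightarrow>
      \<Delta> \<le> (\<Sum>j\<in>{1..n}. (A k j - A k' j)\<^sup>2)"
    and s: "\<And>t. t \<in> {1..T} \<Longrightarrow> s t \<in> {1..nL}"
    and feas: "feasible nL T g z"
    and many: "\<And>k i. k \<in> {1..nL} \<Longrightarrow> i \<in> {1..nL} \<Longrightarrow> k \<noteq> i \<Longrightarrow>
      \<eta> < real (card {t\<in>{1..T}. s t = k \<and> \<not> g t i})"
    and mis: "\<eta> < real (mislabeled T s z)"
    and \<Delta>: "0 \<le> \<Delta>"
  shows "\<eta> * \<Delta> / 4 \<le> sq_gap n T A P s z"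
proof -
  define D where "D k i = (\<Sum>j\<in>{1..n}. (A k j - P i j)\<^sup>2)" for k i
  \<comment> \<open>If no row of \<open>A\<close> is close to row \<open>i\<close> of
    \<open>P\<close>, the default \<open>i\<close> merely keeps \<open>\<kappa>\<close> inside the
    set of leaders; every row of \<open>A\<close> is then far from row \<open>i\<close>.\<close>
  define \<kappa> where "\<kappa> i = (if \<exists>k\<in>{1..nL}. D k i < \<Delta> / 4
    then SOME k. k \<in> {1..nL} \<and> D k i < \<Delta> / 4 else i)" for i
  have \<kappa>_close: "\<kappa> i \<in> {1..nL} \<and> D (\<kappa> i) i < \<Delta> / 4" if "\<exists>k\<in>{1..nL}. D k i < \<Delta> / 4" for i
  proof -
    have "\<exists>k. k \<in> {1..nL} \<and> D k i < \<Delta> / 4" using that by blast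
    from someI_ex[OF this] that show ?thesis by (simp add: \<kappa>_def)
  qed
  have \<kappa>_range: "\<kappa> i \<in> {1..nL}" if "i \<in> {1..nL}" for i
    using \<kappa>_close[of i] that by (cases "\<exists>k\<in>{1..nL}. D k i < \<Delta> / 4") (auto simp: \<kappa>_def)
  \<comment> \<open>The threshold \<Delta> / 4 comes from (a - b)^2 \<le> 2 (a - p)^2 + 2 (b - p)^2:
    two distinct rows of \<open>A\<close> below it would be at squared distance less than
    \<Delta>.\<close>
  have D_ge: "\<Delta> / 4 \<le> D k i" if k: "k \<in> {1..nL}" and ne: "k \<noteq> \<kappa> i" for k i
  proof (rule ccontr)
    assume "\<not> \<Delta> / 4 \<le> D k i"
    hence lt: "D k i < \<Delta> / 4" by simp
    with k have "\<exists>k\<in>{1..nL}. D k i < \<Delta> / 4" by blast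
    note \<kappa> = \<kappa>_close[OF this]
    have "\<Delta> \<le> (\<Sum>j\<in>{1..n}. (A k j - A (\<kappa> i) j)\<^sup>2)" using sep k \<kappa> ne by blast
    also have "\<dots> \<le> (\<Sum>j\<in>{1..n}. 2 * (A k j - P i j)\<^sup>2 + 2 * (A (\<kappa> i) j - P i j)\<^sup>2)"
    proof (rule sum_mono)
      fix j
      have "0 \<le> ((A k j - P i j) + (A (\<kappa> i) j - P i j))\<^sup>2" by simp
      thus "(A k j - A (\<kappa> i) j)\<^sup>2 \<le> 2 * (A k j - P i j)\<^sup>2 + 2 * (A (\<kappa> i) j - P i j)\<^sup>2"
        by (simp add: power2_eq_square algebra_simps)
    qed
    also have "\<dots> = 2 * D k i + 2 * D (\<kappa> i) i"
      by (simp add: D_def sum.distrib sum_distrib_left)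
    finally show False using lt \<kappa> by simp
  qed
  \<comment> \<open>By \<open>D_ge\<close> every group in \<open>W\<close> contributes at least
    \<Delta> / 4 to the gap, so it remains to show that \<open>W\<close> has more than \<eta>
    elements.\<close>
  define W where "W = {t\<in>{1..T}. s t \<noteq> \<kappa> (z t)}"
  have z: "z t \<in> {1..nL}" "g t (z t)" if "t \<in> {1..T}" for t
    using feas that by (auto simp: feasible_def)
  have "\<eta> < real (card W)"
  proof (rule ccontr)
    assume "\<not> \<eta> < real (card W)"
    hence W_le: "real (card W) \<le> \<eta>" by simp
    have not_sub: "\<not> {t\<in>{1..T}. s t = k \<and> \<not> g t i} \<subseteq> W"
      if "k \<in> {1..nL}" "i \<in> {1..nL}" "k \<noteq> i" for k i
    proof
      assume "{t\<in>{1..T}. s t = k \<and> \<not> g t i} \<subseteq> W"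
      hence "card {t\<in>{1..T}. s t = k \<and> \<not> g t i} \<le> card W"
        by (intro card_mono) (auto simp: W_def)
      with many[OF that] W_le show False by simp
    qed
    have "{1..nL} \<subseteq> \<kappa> ` {1..nL}"
    proof (rule ccontr)
      assume "\<not> {1..nL} \<subseteq> \<kappa> ` {1..nL}"
      then obtain k where k: "k \<in> {1..nL}" "k \<notin> \<kappa> ` {1..nL}" by blast
      \<comment> \<open>All groups with hub \<open>k\<close> lie in \<open>W\<close>, as
        \<open>\<kappa>\<close> misses \<open>k\<close>. To count them, \<open>many\<close> needs a
        second leader; \<open>\<kappa> k\<close> serves, being in the image and hence different from
        \<open>k\<close>.\<close>
      with \<kappa>_range[OF k(1)] have "\<not> {t\<in>{1..T}. s t = k \<and> \<not> g t (\<kappa> k)} \<subseteq> W"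
        by (intro not_sub) auto
      moreover have "{t\<in>{1..T}. s t = k \<and> \<not> g t (\<kappa> k)} \<subseteq> W"
        using k z by (auto simp: W_def)
      ultimately show False by contradiction
    qed
    hence "inj_on \<kappa> {1..nL}"
      using \<kappa>_range by (intro finite_surj_inj) auto
    \<comment> \<open>Otherwise some group outside \<open>W\<close> has hub
      \<open>\<kappa> i\<close> and does not contain \<open>i\<close>. Injectivity gives it the
      label \<open>i\<close> under \<open>z\<close>, which feasibility forbids.\<close>
    have \<kappa>_id: "\<kappa> i = i" if i: "i \<in> {1..nL}" for i
    proof (rule ccontr)
      assume "\<kappa> i \<noteq> i"
      hence "\<not> {t\<in>{1..T}. s t = \<kappa> i \<and> \<not> g t i} \<subseteq> W"
        using \<kappa>_range i by (intro not_sub) auto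
      then obtain t where t: "t \<in> {1..T}" "\<not> g t i" and "s t = \<kappa> i" "s t = \<kappa> (z t)"
        unfolding W_def by blast
      hence "\<kappa> (z t) = \<kappa> i" by simp
      with t \<open>inj_on \<kappa> {1..nL}\<close> z[OF t(1)] i show False by (auto dest: inj_onD)
    qed
    have "mislabeled T s z = card {t\<in>{1..T}. s t \<noteq> z t}"
      unfolding mislabeled_def by (simp add: Int_def conj_commute)
    also have "{t\<in>{1..T}. s t \<noteq> z t} = W" using \<kappa>_id z by (auto simp: W_def)
    finally show False using mis W_le by simp
  qed
  hence "\<eta> * (\<Delta> / 4) \<le> real (card W) * (\<Delta> / 4)" using \<Delta> by (intro mult_right_mono) auto
  also have "\<dots> = (\<Sum>t\<in>W. \<Delta> / 4)" by simp
  also have "\<dots> \<le> (\<Sum>t\<in>W. D (s t) (z t))"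
    using s by (intro sum_mono D_ge) (auto simp: W_def)
  also have "\<dots> \<le> (\<Sum>t\<in>{1..T}. D (s t) (z t))"
    by (intro sum_mono2) (auto simp: W_def D_def intro!: sum_nonneg)
  finally show ?thesis by (simp add: sq_gap_def D_def)
qed

section \<open>Law of the data\<close>

context asymmetric_hub_model
begin

lemma measurable_hub: "t \<in> {1..T} \<Longrightarrow> zs t \<in> measurable M (count_space UNIV)"
  and measurable_node: "t \<in> {1..T} \<Longrightarrow> j \<in> {1..n} \<Longrightarrow> G t j \<in> measurable M (count_space UNIV)"
proof -
  assume t: "t \<in> {1..T}"
  have rv: "(\<lambda>\<omega>. (zs t \<omega>, \<lambda>j\<in>{1..n}. G t j \<omega>)) \<in>
      measurable M (count_space UNIV \<Otimes>\<^sub>M (\<Pi>\<^sub>M j\<in>{1..n}. count_space UNIV))"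
    using groups_indep t unfolding indep_vars_def by blast
  show "zs t \<in> measurable M (count_space UNIV)"
    using measurable_compose[OF rv measurable_fst] by simp
  assume j: "j \<in> {1..n}"
  show "G t j \<in> measurable M (count_space UNIV)"
    using measurable_compose[OF measurable_compose[OF rv measurable_snd]
        measurable_component_singleton[OF j]] j by simp
qed

lemma sets_hub: "t \<in> {1..T} \<Longrightarrow> {\<omega> \<in> space M. zs t \<omega> = i} \<in> events"
  using measurable_hub[of t] by measurable

lemma prob_space_given_hub:
  assumes "t \<in> {1..T}" "i \<in> {1..nL}" "\<rho> i > 0"
  shows "prob_space (uniform_measure M {\<omega> \<in> space M. zs t \<omega> = i})"
  using hub_law[OF assms(1,2)] assms(3)
  by (intro prob_space_uniform_measure) (auto simp: emeasure_eq_measure)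

lemma measure_given_hub:
  assumes "t \<in> {1..T}" "i \<in> {1..nL}" "\<rho> i > 0" "B \<in> events"
  shows "prob ({\<omega> \<in> space M. zs t \<omega> = i} \<inter> B) =
    \<rho> i * measure (uniform_measure M {\<omega> \<in> space M. zs t \<omega> = i}) B"
  using hub_law[OF assms(1,2)] assms(3,4) by (subst measure_uniform_measure) (auto simp: emeasure_eq_measure)

lemma given_hub_node_mass:
  assumes "t \<in> {1..T}" "i \<in> {1..nL}" "\<rho> i > 0" "j \<in> {1..n}"
  shows "measure (uniform_measure M {\<omega> \<in> space M. zs t \<omega> = i}) {\<omega> \<in> space M. G t j \<omega> = b} =
    bern_mass (A i j) b"
proof -
  interpret U: prob_space "uniform_measure M {\<omega> \<in> space M. zs t \<omega> = i}"
    by (rule prob_space_given_hub[OF assms(1-3)])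
  have ev: "{\<omega> \<in> space M. G t j \<omega>} \<in> events"
    using measurable_node[OF assms(1,4)] by measurable
  have law: "U.prob {\<omega> \<in> space M. G t j \<omega>} = A i j"
    using node_cond_law[OF assms] by simp
  have "U.prob {\<omega> \<in> space M. \<not> G t j \<omega>} = 1 - A i j"
    using U.prob_neg[of "G t j"] law ev by simp
  with law show ?thesis by (cases b) (auto simp: bern_mass_def)
qed

lemma prob_hub_node_absent:
  assumes "t \<in> {1..T}" "i \<in> {1..nL}" "\<rho> i > 0" "j \<in> {1..n}"
  shows "\<P>(\<omega> in M. zs t \<omega> = i \<and> \<not> G t j \<omega>) = \<rho> i * (1 - A i j)"
proof -
  have ev: "{\<omega> \<in> space M. G t j \<omega> = False} \<in> events"
    using measurable_node[OF assms(1,4)] by measurable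
  have "{\<omega> \<in> space M. zs t \<omega> = i \<and> \<not> G t j \<omega>} =
      {\<omega> \<in> space M. zs t \<omega> = i} \<inter> {\<omega> \<in> space M. G t j \<omega> = False}" by auto
  thus ?thesis
    using measure_given_hub[OF assms(1-3) ev] given_hub_node_mass[OF assms, of False]
    by (simp add: bern_mass_def)
qed

lemma prob_group_mass:
  assumes t: "t \<in> {1..T}" and i: "i \<in> {1..nL}" and pos: "\<rho> i > 0"
  shows "\<P>(\<omega> in M. zs t \<omega> = i \<and> (\<forall>j\<in>{1..n}. G t j \<omega> = h j)) =
    \<rho> i * (\<Prod>j\<in>{1..n}. bern_mass (A i j) (h j))"
proof -
  let ?U = "uniform_measure M {\<omega> \<in> space M. zs t \<omega> = i}"
  interpret U: prob_space ?U by (rule prob_space_given_hub[OF assms])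
  \<comment> \<open>The product rule for independent variables is for a nonempty index set; a leader
    exists, and leaders are nodes.\<close>
  have ne: "{1..n} \<noteq> {}" using i leaders_le_nodes by auto
  have "U.prob (\<Inter>j\<in>{1..n}. G t j -` {h j} \<inter> space ?U) =
      (\<Prod>j\<in>{1..n}. U.prob (G t j -` {h j} \<inter> space ?U))"
    by (rule U.indep_varsD_finite[OF nodes_cond_indep[OF assms] ne]) auto
  also have "(\<Inter>j\<in>{1..n}. G t j -` {h j} \<inter> space ?U) = {\<omega>\<in>space M. \<forall>j\<in>{1..n}. G t j \<omega> = h j}"
    using ne by auto
  also have "(\<Prod>j\<in>{1..n}. U.prob (G t j -` {h j} \<inter> space ?U)) =
      (\<Prod>j\<in>{1..n}. bern_mass (A i j) (h j))"
  proof (rule prod.cong[OF refl])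
    fix j assume j: "j \<in> {1..n}"
    have "G t j -` {h j} \<inter> space ?U = {\<omega>\<in>space M. G t j \<omega> = h j}" by auto
    thus "U.prob (G t j -` {h j} \<inter> space ?U) = bern_mass (A i j) (h j)"
      using given_hub_node_mass[OF assms j] by simp
  qed
  finally have U: "U.prob {\<omega>\<in>space M. \<forall>j\<in>{1..n}. G t j \<omega> = h j} =
      (\<Prod>j\<in>{1..n}. bern_mass (A i j) (h j))" .
  have "{\<omega>\<in>space M. G t j \<omega> = h j} \<in> events" if "j \<in> {1..n}" for j
    using measurable_node[OF t that] by measurable
  hence ev: "{\<omega>\<in>space M. \<forall>j\<in>{1..n}. G t j \<omega> = h j} \<in> events"
    by (intro sets.sets_Collect_finite_All) auto
  have "{\<omega>\<in>space M. zs t \<omega> = i \<and> (\<forall>j\<in>{1..n}. G t j \<omega> = h j)} =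
      {\<omega>\<in>space M. zs t \<omega> = i} \<inter> {\<omega>\<in>space M. \<forall>j\<in>{1..n}. G t j \<omega> = h j}" by auto
  thus ?thesis using measure_given_hub[OF assms ev] U by simp
qed

definition data_atom :: "(nat \<Rightarrow> nat) \<Rightarrow> (nat \<Rightarrow> nat \<Rightarrow> bool) \<Rightarrow> 'a set" where
  "data_atom s g =
    {\<omega>\<in>space M. \<forall>t\<in>{1..T}. zs t \<omega> = s t \<and> (\<forall>j\<in>{1..n}. G t j \<omega> = g t j)}"

lemma sets_data_atom: "data_atom s g \<in> events"
proof -
  have "{\<omega>\<in>space M. zs t \<omega> = s t \<and> (\<forall>j\<in>{1..n}. G t j \<omega> = g t j)} \<in> events"
    if t: "t \<in> {1..T}" for t
  proof -
    have "{\<omega>\<in>space M. G t j \<omega> = g t j} \<in> events" if "j \<in> {1..n}" for j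
      using measurable_node[OF t that] by measurable
    thus ?thesis
      by (intro sets.sets_Collect_conj sets_hub t sets.sets_Collect_finite_All) auto
  qed
  thus ?thesis unfolding data_atom_def by (intro sets.sets_Collect_finite_All) auto
qed

text \<open>Independence across groups reduces the atom to single groups, and conditional
  independence of the nodes gives the mass of each. The label weights split off, leaving
  \<open>hub_lik\<close>.\<close>

lemma prob_data_atom:
  assumes pos: "\<And>i. i \<in> {1..nL} \<Longrightarrow> \<rho> i > 0"
    and s: "\<And>t. t \<in> {1..T} \<Longrightarrow> s t \<in> {1..nL}"
  shows "prob (data_atom s g) = (\<Prod>t\<in>{1..T}. \<rho> (s t)) * hub_lik n T A s g"
\<comment> \<open>Without groups the atom is the whole space; the product rule applies only to a
  nonempty set of groups.\<close>
proof (cases "T = 0")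
  case True
  hence "data_atom s g = space M" unfolding data_atom_def by auto
  thus ?thesis using True by (simp only: prob_space) (simp add: hub_lik_def)
next
  case False
  have one_mem: "1 \<in> {1..T}" using False by simp
  let ?X = "\<lambda>t \<omega>. (zs t \<omega>, \<lambda>j\<in>{1..n}. G t j \<omega>)"
  let ?C = "\<lambda>t. {s t} \<times> (\<Pi>\<^sub>E j\<in>{1..n}. {g t j})"
  have C: "?C t \<in> sets (count_space UNIV \<Otimes>\<^sub>M (\<Pi>\<^sub>M j\<in>{1..n}. count_space UNIV))" for t
    by (intro pair_measureI sets_PiM_I_finite) auto
  have pre: "?X t -` ?C t \<inter> space M =
      {\<omega>\<in>space M. zs t \<omega> = s t \<and> (\<forall>j\<in>{1..n}. G t j \<omega> = g t j)}" for t
    by (rule set_eqI) (simp add: restrict_PiE_iff Pi_iff conj_commute)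
  have eq: "data_atom s g = (\<Inter>t\<in>{1..T}. ?X t -` ?C t \<inter> space M)"
    unfolding pre data_atom_def using one_mem by blast
  have "prob (data_atom s g) = (\<Prod>t\<in>{1..T}. prob (?X t -` ?C t \<inter> space M))"
    unfolding eq using False C by (intro indep_varsD_finite[OF groups_indep]) auto
  also have "\<dots> = (\<Prod>t\<in>{1..T}. \<rho> (s t) * (\<Prod>j\<in>{1..n}. bern_mass (A (s t) j) (g t j)))"
    unfolding pre by (intro prod.cong refl prob_group_mass pos s)
  finally show ?thesis by (simp add: hub_lik_def prod.distrib)
qed

text \<open>The label probabilities sum to 1, and a hub is missing from its own group with
  probability \<rho> i (1 - A i i) = 0. Thus the true labels compete in the maximization.\<close>

lemma AE_hub_feasible:
  assumes pos: "\<And>i. i \<in> {1..nL} \<Longrightarrow> \<rho> i > 0"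
  shows "AE \<omega> in M. feasible nL T (\<lambda>t j. G t j \<omega>) (\<lambda>t. zs t \<omega>)"
proof -
  have "AE \<omega> in M. zs t \<omega> \<in> {1..nL} \<and> G t (zs t \<omega>) \<omega>" if t: "t \<in> {1..T}" for t
  proof -
    have eq: "{\<omega>\<in>space M. zs t \<omega> \<in> {1..nL}} = (\<Union>i\<in>{1..nL}. {\<omega>\<in>space M. zs t \<omega> = i})" by auto
    have "prob {\<omega>\<in>space M. zs t \<omega> \<in> {1..nL}} = (\<Sum>i\<in>{1..nL}. prob {\<omega>\<in>space M. zs t \<omega> = i})"
      unfolding eq using sets_hub[OF t]
      by (intro finite_measure_finite_Union) (auto simp: disjoint_family_on_def)
    also have "\<dots> = 1" using hub_law[OF t] rho_sum by simp
    finally have "prob {\<omega>\<in>space M. zs t \<omega> \<in> {1..nL}} = 1" .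
    moreover have "{\<omega>\<in>space M. zs t \<omega> \<in> {1..nL}} \<in> events"
      unfolding eq using sets_hub[OF t] by (intro sets.finite_UN) auto
    ultimately have "AE \<omega> in M. \<omega> \<in> {\<omega>\<in>space M. zs t \<omega> \<in> {1..nL}}"
      using prob_eq_1 by simp
    moreover have "AE \<omega> in M. \<not> (zs t \<omega> = i \<and> \<not> G t i \<omega>)" if i: "i \<in> {1..nL}" for i
    proof -
      have i': "i \<in> {1..n}" using i leaders_le_nodes by auto
      have "{\<omega>\<in>space M. zs t \<omega> = i \<and> \<not> G t i \<omega>} \<in> events"
        using sets_hub[OF t] measurable_node[OF t i'] by measurable
      thus ?thesis
        using prob_hub_node_absent[OF t i pos[OF i] i'] A_diag[OF i]
        by (intro AE_I[where N = "{\<omega>\<in>space M. zs t \<omega> = i \<and> \<not> G t i \<omega>}"])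
          (auto simp: emeasure_eq_measure)
    qed
    hence "AE \<omega> in M. \<forall>i\<in>{1..nL}. \<not> (zs t \<omega> = i \<and> \<not> G t i \<omega>)"
      by (intro AE_finite_allI) auto
    ultimately show ?thesis by eventually_elim auto
  qed
  hence "AE \<omega> in M. \<forall>t\<in>{1..T}. zs t \<omega> \<in> {1..nL} \<and> G t (zs t \<omega>) \<omega>"
    by (intro AE_finite_allI) auto
  thus ?thesis by (simp add: feasible_def)
qed

text \<open>The count is a sum of independent indicators with mean at least 2 \<beta> each, so the
  event is a deviation by at least \<beta> T, to which Hoeffding's inequality applies.\<close>

lemma prob_few_absent:
  assumes k: "k \<in> {1..nL}" and i: "i \<in> {1..nL}" and pos: "\<rho> k > 0"
    and \<beta>: "0 \<le> \<beta>" "2 * \<beta> \<le> \<rho> k * (1 - A k i)" and T: "0 < T"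
  shows "\<P>(\<omega> in M. real (card {t\<in>{1..T}. zs t \<omega> = k \<and> \<not> G t i \<omega>}) \<le> \<beta> * real T)
    \<le> exp (- 2 * \<beta>\<^sup>2 * real T)"
proof -
  have i': "i \<in> {1..n}" using i leaders_le_nodes by auto
  define X where "X t \<omega> = (of_bool (zs t \<omega> = k \<and> \<not> G t i \<omega>) :: real)" for t \<omega>
  \<comment> \<open>Independence is assumed for the pairs of a hub and a restricted row, so the
    indicators are written as functions of these pairs.\<close>
  have "indep_vars (\<lambda>_. borel) (\<lambda>t \<omega>. (\<lambda>(a, h). of_bool (a = k \<and> \<not> h i) :: real)
      (zs t \<omega>, \<lambda>j\<in>{1..n}. G t j \<omega>)) {1..T}"
  proof (rule indep_vars_compose2[OF groups_indep])
    fix t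
    have [measurable]: "(\<lambda>h. h i) \<in> measurable (\<Pi>\<^sub>M j\<in>{1..n}. count_space (UNIV :: bool set)) (count_space UNIV)"
      by (rule measurable_component_singleton[OF i'])
    show "(\<lambda>(a, h). of_bool (a = k \<and> \<not> h i) :: real) \<in>
      borel_measurable (count_space UNIV \<Otimes>\<^sub>M (\<Pi>\<^sub>M j\<in>{1..n}. count_space UNIV))"
      by measurable
  qed
  hence indep: "indep_vars (\<lambda>_. borel) X {1..T}"
    using i' by (simp add: X_def[abs_def])
  interpret Hoeffding_ineq M "{1..T}" X "\<lambda>_. 0" "\<lambda>_. 1" "\<Sum>t\<in>{1..T}. expectation (X t)"
    using indep by unfold_locales (auto simp: X_def)
  have "expectation (X t) = \<rho> k * (1 - A k i)" if t: "t \<in> {1..T}" for t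
  proof -
    have ev: "{\<omega>\<in>space M. zs t \<omega> = k \<and> \<not> G t i \<omega>} \<in> events"
      using sets_hub[OF t] measurable_node[OF t i'] by measurable
    have "expectation (X t) = expectation (indicator {\<omega>\<in>space M. zs t \<omega> = k \<and> \<not> G t i \<omega>})"
      by (intro Bochner_Integration.integral_cong) (auto simp: X_def indicator_def)
    also have "\<dots> = \<P>(\<omega> in M. zs t \<omega> = k \<and> \<not> G t i \<omega>)" using ev by simp
    finally show ?thesis using prob_hub_node_absent[OF t k pos i'] by simp
  qed
  hence \<mu>: "(\<Sum>t\<in>{1..T}. expectation (X t)) = real T * (\<rho> k * (1 - A k i))" by simp
  have "real T * (2 * \<beta>) \<le> real T * (\<rho> k * (1 - A k i))"
    using \<beta> by (intro mult_left_mono) auto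
  hence le: "\<beta> * real T \<le> (\<Sum>t\<in>{1..T}. expectation (X t)) - \<beta> * real T"
    unfolding \<mu> by (simp add: algebra_simps)
  have X_sum: "(\<Sum>t\<in>{1..T}. X t \<omega>) = real (card {t\<in>{1..T}. zs t \<omega> = k \<and> \<not> G t i \<omega>})" for \<omega>
    by (simp add: X_def Int_def conj_commute)
  have "\<P>(\<omega> in M. real (card {t\<in>{1..T}. zs t \<omega> = k \<and> \<not> G t i \<omega>}) \<le> \<beta> * real T)
      \<le> \<P>(\<omega> in M. (\<Sum>t\<in>{1..T}. X t \<omega>) \<le> (\<Sum>t\<in>{1..T}. expectation (X t)) - \<beta> * real T)"
    unfolding X_sum[symmetric]
  proof (rule finite_measure_mono)
    show "{\<omega>\<in>space M. (\<Sum>t\<in>{1..T}. X t \<omega>) \<le> (\<Sum>t\<in>{1..T}. expectation (X t)) - \<beta> * real T} \<in> events"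
      by measurable
  qed (use le in auto)
  also have "\<dots> \<le> exp (- 2 * (\<beta> * real T)\<^sup>2 / (\<Sum>t\<in>{1..T}. (1 - 0)\<^sup>2))"
    using \<beta> T by (intro Hoeffding_ineq_le) auto
  also have "\<dots> = exp (- 2 * \<beta>\<^sup>2 * real T)"
    using T by (simp add: power2_eq_square)
  finally show ?thesis .
qed

section \<open>Union bound over rivals\<close>

text \<open>The rival \<open>(z, P)\<close> is nonrandom here: it is far from the truth, and yet at
  least as likely.\<close>

definition rival_event :: "(nat \<Rightarrow> nat) \<Rightarrow> (nat \<Rightarrow> nat \<Rightarrow> real) \<Rightarrow> real \<Rightarrow> 'a set" where
  "rival_event z P \<tau> = {\<omega>\<in>space M. (\<forall>t\<in>{1..T}. zs t \<omega> \<in> {1..nL}) \<and>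
    \<tau> \<le> sq_gap n T A P (\<lambda>t. zs t \<omega>) z \<and>
    hub_lik n T A (\<lambda>t. zs t \<omega>) (\<lambda>t j. G t j \<omega>) \<le> hub_lik n T P z (\<lambda>t j. G t j \<omega>)}"

text \<open>The event depends on the data only inside the index ranges, so it is a finite union of
  atoms. This gives its measurability and lets its probability be summed.\<close>

lemma rival_event_eq:
  "rival_event z P \<tau> = (\<Union>(s, g)\<in>{(s, g). s \<in> {1..T} \<rightarrow>\<^sub>E {1..nL} \<and> g \<in> {1..T} \<rightarrow>\<^sub>E {1..n} \<rightarrow>\<^sub>E UNIV \<and>
      \<tau> \<le> sq_gap n T A P s z \<and> hub_lik n T A s g \<le> hub_lik n T P z g}. data_atom s g)"
    (is "_ = (\<Union>(s, g)\<in>?C. data_atom s g)")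
proof (intro set_eqI iffI)
  fix \<omega> assume \<omega>: "\<omega> \<in> rival_event z P \<tau>"
  define s where "s = (\<lambda>t\<in>{1..T}. zs t \<omega>)"
  define g where "g = (\<lambda>t\<in>{1..T}. \<lambda>j\<in>{1..n}. G t j \<omega>)"
  have "sq_gap n T A P (\<lambda>t. zs t \<omega>) z = sq_gap n T A P s z"
    by (rule sq_gap_cong) (auto simp: s_def)
  moreover have "hub_lik n T A (\<lambda>t. zs t \<omega>) (\<lambda>t j. G t j \<omega>) = hub_lik n T A s g"
    by (rule hub_lik_cong) (auto simp: s_def g_def)
  moreover have "hub_lik n T P z (\<lambda>t j. G t j \<omega>) = hub_lik n T P z g"
    by (rule hub_lik_cong) (auto simp: g_def)
  moreover have "s \<in> {1..T} \<rightarrow>\<^sub>E {1..nL}" "g \<in> {1..T} \<rightarrow>\<^sub>E {1..n} \<rightarrow>\<^sub>E UNIV"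
    using \<omega> unfolding s_def g_def rival_event_def by (simp_all add: restrict_PiE_iff)
  ultimately have "(s, g) \<in> ?C"
    using \<omega> by (simp add: rival_event_def)
  moreover have "\<omega> \<in> data_atom s g"
    using \<omega> by (simp add: data_atom_def rival_event_def s_def g_def)
  ultimately show "\<omega> \<in> (\<Union>(s, g)\<in>?C. data_atom s g)" by blast
next
  fix \<omega> assume "\<omega> \<in> (\<Union>(s, g)\<in>?C. data_atom s g)"
  then obtain s g where sg: "(s, g) \<in> ?C" and \<omega>: "\<omega> \<in> data_atom s g" by blast
  from \<omega> have eq: "\<And>t. t \<in> {1..T} \<Longrightarrow> zs t \<omega> = s t"
    "\<And>t j. t \<in> {1..T} \<Longrightarrow> j \<in> {1..n} \<Longrightarrow> G t j \<omega> = g t j" "\<omega> \<in> space M"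
    by (auto simp: data_atom_def)
  have "sq_gap n T A P (\<lambda>t. zs t \<omega>) z = sq_gap n T A P s z"
    by (rule sq_gap_cong) (simp_all add: eq)
  moreover have "hub_lik n T A (\<lambda>t. zs t \<omega>) (\<lambda>t j. G t j \<omega>) = hub_lik n T A s g"
    by (rule hub_lik_cong) (simp_all add: eq)
  moreover have "hub_lik n T P z (\<lambda>t j. G t j \<omega>) = hub_lik n T P z g"
    by (rule hub_lik_cong) (simp_all add: eq)
  moreover have "\<forall>t\<in>{1..T}. zs t \<omega> \<in> {1..nL}"
    using sg eq(1) PiE_mem[of s "{1..T}" "\<lambda>_. {1..nL}"] by simp
  ultimately show "\<omega> \<in> rival_event z P \<tau>"
    using sg eq(3) by (simp add: rival_event_def)
qed

lemma finite_data:
  "finite (({1..T} \<rightarrow>\<^sub>E {1..nL}) \<times> ({1..T} \<rightarrow>\<^sub>E {1..n} \<rightarrow>\<^sub>E (UNIV :: bool set)))"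
  by (intro finite_cartesian_product finite_PiE) auto

lemma sets_rival_event: "rival_event z P \<tau> \<in> events"
  unfolding rival_event_eq
  by (intro sets.finite_UN finite_subset[OF _ finite_data]) (auto intro: sets_data_atom)

text \<open>On the event the likelihood of the truth is at most the geometric mean of both
  likelihoods. For fixed true labels, summing this mean over the data gives the affinity; averaging
  over the labels then preserves the bound.\<close>

lemma prob_rival_event_le:
  assumes pos: "\<And>i. i \<in> {1..nL} \<Longrightarrow> \<rho> i > 0"
    and P: "\<And>t j. t \<in> {1..T} \<Longrightarrow> j \<in> {1..n} \<Longrightarrow> P (z t) j \<in> {0..1}"
  shows "prob (rival_event z P \<tau>) \<le> exp (- \<tau> / 4)"
proof -
  let ?S = "{1..T} \<rightarrow>\<^sub>E {1..nL}" and ?G = "{1..T} \<rightarrow>\<^sub>E {1..n} \<rightarrow>\<^sub>E (UNIV :: bool set)"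
  let ?C = "{(s, g). s \<in> ?S \<and> g \<in> ?G \<and>
      \<tau> \<le> sq_gap n T A P s z \<and> hub_lik n T A s g \<le> hub_lik n T P z g}"
  let ?w = "\<lambda>s. \<Prod>t\<in>{1..T}. \<rho> (s t)"
  define S' where "S' = {s\<in>?S. \<tau> \<le> sq_gap n T A P s z}"
  have S_range: "s t \<in> {1..nL}" if "s \<in> ?S" "t \<in> {1..T}" for s t
    using that by (rule PiE_mem)
  have A01: "A (s t) j \<in> {0..1}" if "s \<in> ?S" "t \<in> {1..T}" "j \<in> {1..n}" for s t j
    by (rule A_range[OF S_range[OF that(1,2)] that(3)])
  have w_nonneg: "0 \<le> ?w s" if "s \<in> ?S" for s
    by (intro prod_nonneg ballI less_imp_le pos S_range[OF that])
  have fin_S: "finite ?S" and fin_G: "finite ?G" by (intro finite_PiE; auto)+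
  have C_sub: "?C \<subseteq> S' \<times> ?G" by (auto simp: S'_def)
  have fin: "finite (S' \<times> ?G)" using fin_S fin_G by (simp add: S'_def)
  have likA: "0 \<le> hub_lik n T A s g" if "s \<in> ?S" for s g
    by (intro hub_lik_nonneg A01[OF that])
  have likP: "0 \<le> hub_lik n T P z g" for g by (intro hub_lik_nonneg P)
  have "prob (rival_event z P \<tau>) \<le> (\<Sum>sg\<in>?C. prob (data_atom (fst sg) (snd sg)))"
  proof -
    have eq: "rival_event z P \<tau> = (\<Union>sg\<in>?C. data_atom (fst sg) (snd sg))"
      unfolding rival_event_eq by (intro SUP_cong refl) auto
    show ?thesis unfolding eq
      by (intro finite_measure_subadditive_finite finite_subset[OF C_sub fin] image_subsetI
          sets_data_atom)
  qed
  also have "\<dots> \<le> (\<Sum>sg\<in>?C. ?w (fst sg) * sqrt (hub_lik n T A (fst sg) (snd sg) * hub_lik n T P z (snd sg)))"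
  proof (rule sum_mono)
    fix sg assume sg_C: "sg \<in> ?C"
    obtain s g where sg: "sg = (s, g)" by (cases sg)
    have s: "s \<in> ?S" and le: "hub_lik n T A s g \<le> hub_lik n T P z g"
      using sg_C unfolding sg by simp_all
    have "(hub_lik n T A s g)\<^sup>2 \<le> hub_lik n T A s g * hub_lik n T P z g"
      unfolding power2_eq_square by (intro mult_left_mono le likA s)
    hence "hub_lik n T A s g \<le> sqrt (hub_lik n T A s g * hub_lik n T P z g)"
      by (rule real_le_rsqrt)
    hence "?w s * hub_lik n T A s g \<le> ?w s * sqrt (hub_lik n T A s g * hub_lik n T P z g)"
      by (intro mult_left_mono w_nonneg s)
    thus "prob (data_atom (fst sg) (snd sg)) \<le>
        ?w (fst sg) * sqrt (hub_lik n T A (fst sg) (snd sg) * hub_lik n T P z (snd sg))"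
      using prob_data_atom[of s g, OF pos S_range[OF s]] by (simp add: sg)
  qed
  \<comment> \<open>The comparison of likelihoods has served its purpose and is dropped, so that the
    sum over the data is the full affinity.\<close>
  also have "\<dots> \<le> (\<Sum>sg\<in>S' \<times> ?G. ?w (fst sg) *
      sqrt (hub_lik n T A (fst sg) (snd sg) * hub_lik n T P z (snd sg)))"
  proof (rule sum_mono2[OF fin C_sub])
    fix sg assume "sg \<in> S' \<times> ?G - ?C"
    hence s: "fst sg \<in> ?S" by (auto simp: S'_def)
    show "0 \<le> ?w (fst sg) * sqrt (hub_lik n T A (fst sg) (snd sg) * hub_lik n T P z (snd sg))"
      by (intro mult_nonneg_nonneg w_nonneg real_sqrt_ge_zero likA likP s)
  qed
  also have "\<dots> = (\<Sum>s\<in>S'. ?w s * (\<Sum>g\<in>?G. sqrt (hub_lik n T A s g * hub_lik n T P z g)))"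
    by (simp add: sum.cartesian_product' sum_distrib_left)
  also have "\<dots> \<le> (\<Sum>s\<in>S'. ?w s * exp (- \<tau> / 4))"
  proof (rule sum_mono)
    fix s assume "s \<in> S'"
    hence s: "s \<in> ?S" and ge: "\<tau> \<le> sq_gap n T A P s z" by (auto simp: S'_def)
    have "(\<Sum>g\<in>?G. sqrt (hub_lik n T A s g * hub_lik n T P z g)) \<le> exp (- sq_gap n T A P s z / 4)"
      by (intro hub_lik_affinity_le A01[OF s] P)
    also have "\<dots> \<le> exp (- \<tau> / 4)" using ge by simp
    finally show "?w s * (\<Sum>g\<in>?G. sqrt (hub_lik n T A s g * hub_lik n T P z g)) \<le> ?w s * exp (- \<tau> / 4)"
      by (intro mult_left_mono w_nonneg s)
  qed
  also have "\<dots> \<le> (\<Sum>s\<in>?S. ?w s * exp (- \<tau> / 4))"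
    using fin_S w_nonneg by (intro sum_mono2) (auto simp: S'_def)
  also have "\<dots> = (\<Sum>s\<in>?S. ?w s) * exp (- \<tau> / 4)" by (simp add: sum_distrib_right)
  \<comment> \<open>The total weight of all label vectors is the \<open>T\<close>-th power of the
    sum of \<rho>.\<close>
  also have "(\<Sum>s\<in>?S. ?w s) = 1"
    using rho_sum by (subst prod_sum_PiE[symmetric]) auto
  finally show ?thesis by simp
qed

text \<open>The bad events are \<open>B1\<close>, where some leader is absent from too few groups of
  another, and \<open>B2\<close>, where some rival from the finite family
  \<open>Z \<times> Q\<close> is far and at least as likely as the truth. Outside \<open>B1\<close>,
  too many mislabeled groups make the estimate with its frequencies such a rival. The two summands
  are union bounds over pairs of leaders and over rivals.\<close>

lemma prob_mislabeled_le:
  assumes pos: "\<And>i. i \<in> {1..nL} \<Longrightarrow> \<rho> i > 0"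
    and sep: "\<And>k k'. k \<in> {1..nL} \<Longrightarrow> k' \<in> {1..nL} \<Longrightarrow> k \<noteq> k' \<Longrightarrow>
      \<Delta> \<le> (\<Sum>j\<in>{1..n}. (A k j - A k' j)\<^sup>2)"
    and \<Delta>: "0 \<le> \<Delta>"
    and \<beta>: "0 \<le> \<beta>" "\<And>k i. k \<in> {1..nL} \<Longrightarrow> i \<in> {1..nL} \<Longrightarrow> k \<noteq> i \<Longrightarrow> 2 * \<beta> \<le> \<rho> k * (1 - A k i)"
    and \<eta>: "\<eta> \<le> \<beta>" "\<eta> \<le> \<epsilon>" and T: "0 < T"
    and mle: "AE \<omega> in M. profile_mle nL n T (\<lambda>t j. G t j \<omega>) (\<lambda>t. zhat t \<omega>)"
  shows "\<P>(\<omega> in M. real (mislabeled T (\<lambda>t. zs t \<omega>) (\<lambda>t. zhat t \<omega>)) / real T > \<epsilon>)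
    \<le> real nL ^ 2 * exp (- 2 * \<beta>\<^sup>2 * real T)
      + real nL ^ T * (real (T + 1) ^ 2) ^ (nL * n) * exp (- (\<eta> * real T * \<Delta> / 16))"
proof -
  define few where
    "few k i = {\<omega>\<in>space M. real (card {t\<in>{1..T}. zs t \<omega> = k \<and> \<not> G t i \<omega>}) \<le> \<beta> * real T}" for k i
  define K where "K = {(k, i). k \<in> {1..nL} \<and> i \<in> {1..nL} \<and> k \<noteq> i}"
  define Z where "Z = ({1..T} \<rightarrow>\<^sub>E {1..nL})"
  define Q where "Q = ({1..nL} \<rightarrow>\<^sub>E {1..n} \<rightarrow>\<^sub>E frac_grid T)"
  \<comment> \<open>The gap from \<open>sq_gap_ge_of_mislabeled\<close> for more than \<eta> T
    mislabeled groups; the further factor 1/4 of \<open>prob_rival_event_le\<close> turns 4 into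
    16.\<close>
  define \<tau> where "\<tau> = \<eta> * real T * \<Delta> / 4"
  define B1 where "B1 = (\<Union>(k, i)\<in>K. few k i)"
  define B2 where "B2 = (\<Union>(z, P)\<in>Z \<times> Q. rival_event z P \<tau>)"
  have K_sub: "K \<subseteq> {1..nL} \<times> {1..nL}" by (auto simp: K_def)
  have fin_K: "finite K" by (rule finite_subset[OF K_sub]) simp
  have fin_ZQ: "finite (Z \<times> Q)"
    unfolding Z_def Q_def
    by (intro finite_cartesian_product finite_PiE finite_frac_grid) auto
  have few_events: "few k i \<in> events" if ki: "(k, i) \<in> K" for k i
  proof -
    have [measurable]: "Measurable.pred M (\<lambda>\<omega>. zs t \<omega> = k \<and> \<not> G t i \<omega>)" if t: "t \<in> {1..T}" for t
    proof -
      have "i \<in> {1..n}" using ki leaders_le_nodes by (auto simp: K_def)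
      thus ?thesis using measurable_hub[OF t] measurable_node[OF t] by measurable
    qed
    \<comment> \<open>The cardinality is measurable as a sum of indicators.\<close>
    have "(\<lambda>\<omega>. \<Sum>t\<in>{1..T}. (of_bool (zs t \<omega> = k \<and> \<not> G t i \<omega>) :: real)) \<in> borel_measurable M"
      by measurable
    hence "{\<omega>\<in>space M. (\<Sum>t\<in>{1..T}. (of_bool (zs t \<omega> = k \<and> \<not> G t i \<omega>) :: real)) \<le> \<beta> * real T} \<in> events"
      by measurable
    moreover have "(\<Sum>t\<in>{1..T}. (of_bool (zs t \<omega> = k \<and> \<not> G t i \<omega>) :: real)) =
        real (card {t\<in>{1..T}. zs t \<omega> = k \<and> \<not> G t i \<omega>})" for \<omega>
      by (simp add: Int_def conj_commute)
    ultimately show ?thesis by (simp only: few_def)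
  qed
  have B1_events: "B1 \<in> events"
    unfolding B1_def by (intro sets.finite_UN fin_K) (auto intro!: few_events)
  have B2_events: "B2 \<in> events"
    unfolding B2_def by (intro sets.finite_UN fin_ZQ) (auto intro!: sets_rival_event)
  have "prob B1 \<le> (\<Sum>ki\<in>K. prob (few (fst ki) (snd ki)))"
    unfolding B1_def case_prod_beta
    by (intro finite_measure_subadditive_finite fin_K) (auto intro!: few_events)
  also have "\<dots> \<le> (\<Sum>ki\<in>K. exp (- 2 * \<beta>\<^sup>2 * real T))"
    unfolding few_def using \<beta> pos T by (intro sum_mono prob_few_absent) (auto simp: K_def)
  also have "\<dots> = real (card K) * exp (- 2 * \<beta>\<^sup>2 * real T)" by simp
  also have "\<dots> \<le> real nL ^ 2 * exp (- 2 * \<beta>\<^sup>2 * real T)"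
  proof -
    have "card K \<le> nL ^ 2"
      using card_mono[OF _ K_sub] by (simp add: power2_eq_square)
    hence "real (card K) \<le> real nL ^ 2" by (metis of_nat_le_iff of_nat_power)
    thus ?thesis by (intro mult_right_mono) auto
  qed
  finally have B1_le: "prob B1 \<le> real nL ^ 2 * exp (- 2 * \<beta>\<^sup>2 * real T)" .
  have "prob B2 \<le> (\<Sum>zP\<in>Z \<times> Q. prob (rival_event (fst zP) (snd zP) \<tau>))"
    unfolding B2_def case_prod_beta
    by (intro finite_measure_subadditive_finite fin_ZQ) (auto intro!: sets_rival_event)
  also have "\<dots> \<le> (\<Sum>zP\<in>Z \<times> Q. exp (- \<tau> / 4))"
  proof (rule sum_mono)
    fix zP assume "zP \<in> Z \<times> Q"
    then obtain z P where zP: "zP = (z, P)" "z \<in> Z" "P \<in> Q" by blast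
    have "P (z t) j \<in> {0..1}" if "t \<in> {1..T}" "j \<in> {1..n}" for t j
    proof (rule frac_grid_range)
      have "z t \<in> {1..nL}" using zP(2) that(1) unfolding Z_def by (rule PiE_mem)
      with zP(3) have "P (z t) \<in> {1..n} \<rightarrow>\<^sub>E frac_grid T" unfolding Q_def by (rule PiE_mem)
      thus "P (z t) j \<in> frac_grid T" using that(2) by (rule PiE_mem)
    qed
    from prob_rival_event_le[of P z \<tau>, OF pos this]
    show "prob (rival_event (fst zP) (snd zP) \<tau>) \<le> exp (- \<tau> / 4)" by (simp add: zP)
  qed
  also have "\<dots> = real (card Z * card Q) * exp (- \<tau> / 4)"
    by (simp add: card_cartesian_product)
  also have "\<dots> \<le> (real nL ^ T * (real (T + 1) ^ 2) ^ (nL * n)) * exp (- \<tau> / 4)"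
  proof (rule mult_right_mono)
    have Z: "card Z = nL ^ T" by (simp add: Z_def card_PiE)
    have "card Q = card (frac_grid T) ^ (nL * n)"
      by (simp add: Q_def card_PiE power_mult[symmetric] mult.commute)
    also have "\<dots> \<le> ((T + 1)\<^sup>2) ^ (nL * n)" by (intro power_mono card_frac_grid) simp
    finally have "card Z * card Q \<le> nL ^ T * ((T + 1)\<^sup>2) ^ (nL * n)"
      unfolding Z by (rule mult_left_mono) simp
    hence "real (card Z * card Q) \<le> real (nL ^ T * ((T + 1)\<^sup>2) ^ (nL * n))"
      by (simp only: of_nat_le_iff)
    thus "real (card Z * card Q) \<le> real nL ^ T * (real (T + 1) ^ 2) ^ (nL * n)" by simp
  qed simp
  finally have B2_le: "prob B2 \<le>
      real nL ^ T * (real (T + 1) ^ 2) ^ (nL * n) * exp (- (\<eta> * real T * \<Delta> / 16))"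
    by (simp add: \<tau>_def)
  have feas: "AE \<omega> in M. feasible nL T (\<lambda>t j. G t j \<omega>) (\<lambda>t. zs t \<omega>)"
    by (intro AE_hub_feasible pos)
  \<comment> \<open>The maximizer property and the feasibility of the true labels hold almost
    surely, so the inclusion in the bad events is shown almost everywhere.\<close>
  have "AE \<omega> in M.
    \<omega> \<in> {\<omega>\<in>space M. real (mislabeled T (\<lambda>t. zs t \<omega>) (\<lambda>t. zhat t \<omega>)) / real T > \<epsilon>} \<longrightarrow> \<omega> \<in> B1 \<union> B2"
    using mle feas
  proof eventually_elim
    fix \<omega>
    let ?s = "\<lambda>t. zs t \<omega>" and ?z = "\<lambda>t. zhat t \<omega>" and ?g = "\<lambda>t j. G t j \<omega>"
    assume mle: "profile_mle nL n T ?g ?z" and s: "feasible nL T ?g ?s"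
    show "\<omega> \<in> {\<omega>\<in>space M. real (mislabeled T (\<lambda>t. zs t \<omega>) (\<lambda>t. zhat t \<omega>)) / real T > \<epsilon>}
      \<longrightarrow> \<omega> \<in> B1 \<union> B2"
    proof (intro impI UnCI)
      assume mis: "\<omega> \<in> {\<omega>\<in>space M. real (mislabeled T (\<lambda>t. zs t \<omega>) (\<lambda>t. zhat t \<omega>)) / real T > \<epsilon>}"
        and not_B2: "\<omega> \<notin> B2"
      show "\<omega> \<in> B1"
      proof (rule ccontr)
        assume "\<omega> \<notin> B1"
        have s_range: "zs t \<omega> \<in> {1..nL}" if "t \<in> {1..T}" for t
          using s that by (simp add: feasible_def)
        have z: "feasible nL T ?g ?z"
          using mle by (simp add: profile_mle_def is_arg_max_def)
        hence z_range: "zhat t \<omega> \<in> {1..nL}" if "t \<in> {1..T}" for t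
          using that by (simp add: feasible_def)
        \<comment> \<open>Restriction to the index ranges places the random estimate in the finite
          families \<open>Z\<close> and \<open>Q\<close>; gap and likelihood read only values inside
          these ranges.\<close>
        define z where "z = (\<lambda>t\<in>{1..T}. zhat t \<omega>)"
        define P where "P = (\<lambda>i\<in>{1..nL}. \<lambda>j\<in>{1..n}. A_hat T ?g ?z i j)"
        have "z \<in> Z" unfolding z_def Z_def using z_range by (simp add: restrict_PiE_iff)
        moreover have "P \<in> Q"
          unfolding P_def Q_def by (simp add: restrict_PiE_iff A_hat_in_frac_grid)
        moreover have "\<omega> \<in> rival_event z P \<tau>"
          unfolding rival_event_def
        proof (intro CollectI conjI ballI s_range)
          show "\<omega> \<in> space M" using mis by simp
          have "\<eta> * real T * \<Delta> / 4 \<le> sq_gap n T A (A_hat T ?g ?z) ?s ?z"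
          proof (rule sq_gap_ge_of_mislabeled[OF sep s_range z _ _ \<Delta>])
            fix k i assume "k \<in> {1..nL}" "i \<in> {1..nL}" "k \<noteq> i"
            hence "\<omega> \<notin> few k i" using \<open>\<omega> \<notin> B1\<close> by (auto simp: B1_def K_def)
            hence "\<beta> * real T < real (card {t\<in>{1..T}. zs t \<omega> = k \<and> \<not> G t i \<omega>})"
              using mis by (simp add: few_def)
            moreover have "\<eta> * real T \<le> \<beta> * real T" using \<eta> by (intro mult_right_mono) auto
            ultimately show "\<eta> * real T < real (card {t\<in>{1..T}. zs t \<omega> = k \<and> \<not> G t i \<omega>})"
              by simp
          next
            have "\<eta> * real T \<le> \<epsilon> * real T" using \<eta> by (intro mult_right_mono) auto
            also have "\<dots> < real (mislabeled T ?s ?z)" using mis T by (simp add: field_simps)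
            finally show "\<eta> * real T < real (mislabeled T ?s ?z)" .
          qed
          also have "sq_gap n T A (A_hat T ?g ?z) ?s ?z = sq_gap n T A P ?s z"
            by (rule sq_gap_cong) (use z_range in \<open>simp_all add: P_def z_def\<close>)
          finally show "\<tau> \<le> sq_gap n T A P ?s z" by (simp add: \<tau>_def)
          \<comment> \<open>From the true matrix to the frequencies at the true labels by Gibbs'
            inequality, then to the estimate because the true labels are feasible.\<close>
          have "hub_lik n T A ?s ?g \<le> hub_lik n T (A_hat T ?g ?s) ?s ?g"
            by (intro hub_lik_le_hub_lik_A_hat A_range s_range)
          also have "\<dots> \<le> hub_lik n T (A_hat T ?g ?z) ?z ?g"
            using mle s unfolding exp_profile_log_lik[symmetric] profile_mle_def is_arg_max_def
            by (auto simp: not_less)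
          also have "\<dots> = hub_lik n T P z ?g"
            by (rule hub_lik_cong) (use z_range in \<open>simp_all add: P_def z_def\<close>)
          finally show "hub_lik n T A ?s ?g \<le> hub_lik n T P z ?g" .
        qed
        ultimately have "\<omega> \<in> B2" unfolding B2_def by blast
        with not_B2 show False by contradiction
      qed
    qed
  qed
  hence "\<P>(\<omega> in M. real (mislabeled T (\<lambda>t. zs t \<omega>) (\<lambda>t. zhat t \<omega>)) / real T > \<epsilon>)
      \<le> prob (B1 \<union> B2)"
    by (rule finite_measure_mono_AE) (intro sets.Un B1_events B2_events)
  also have "\<dots> \<le> prob B1 + prob B2"
    by (rule measure_Un_le[OF B1_events B2_events])
  finally show ?thesis using B1_le B2_le by linarith
qed

end

section \<open>Asymptotics of the bound\<close>

text \<open>With N = n and t = T the exponent is t ln L + 2 L N ln (t + 1) - c N t. Large n makes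
  the first term at most c N t / 4, large T the second, and the remainder - c N t / 2 is at most - c
  t / 2.\<close>

lemma union_bound_tendsto_0:
  fixes n T :: "nat \<Rightarrow> nat"
  assumes n: "filterlim n at_top sequentially" and T: "filterlim T at_top sequentially"
    and L: "0 < L" and c: "0 < c"
  shows "(\<lambda>m. real L ^ T m * (real (T m + 1) ^ 2) ^ (L * n m) * exp (- (c * real (n m) * real (T m))))
    \<longlonglongrightarrow> 0"
proof (rule tendsto_sandwich[where f = "\<lambda>_. 0"])
  have T_real: "filterlim (\<lambda>m. real (T m)) at_top sequentially"
    using filterlim_compose[OF filterlim_real_sequentially T] .
  have n_real: "filterlim (\<lambda>m. real (n m)) at_top sequentially"
    using filterlim_compose[OF filterlim_real_sequentially n] .
  have "(\<lambda>m. ln (real (T m)) / real (T m)) \<longlonglongrightarrow> 0"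
    using filterlim_compose[OF lim_ln_over_n T] .
  hence "(\<lambda>m. 4 * real L * (ln (real (T m)) / real (T m))) \<longlonglongrightarrow> 0"
    by (rule tendsto_mult_right_zero)
  \<comment> \<open>The factor 4 combines the exponent 2 of the grid size with ln (t + 1) \<le> 2 ln
    t, valid for t \<ge> 2.\<close>
  hence ev1: "\<forall>\<^sub>F m in sequentially. 4 * real L * (ln (real (T m)) / real (T m)) < c / 4"
    using c by (intro order_tendstoD) auto
  have ev2: "\<forall>\<^sub>F m in sequentially. 4 * ln (real L) / c \<le> real (n m)"
    using n_real by (simp add: filterlim_at_top)
  have ev3: "\<forall>\<^sub>F m in sequentially. 2 \<le> T m" using T by (simp add: filterlim_at_top)
  have ev4: "\<forall>\<^sub>F m in sequentially. 1 \<le> n m" using n by (simp add: filterlim_at_top)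
  show "\<forall>\<^sub>F m in sequentially. real L ^ T m * (real (T m + 1) ^ 2) ^ (L * n m) *
      exp (- (c * real (n m) * real (T m))) \<le> exp (- (c / 2 * real (T m)))"
    using ev1 ev2 ev3 ev4
  proof eventually_elim
    fix m
    define N t where "N = real (n m)" and "t = real (T m)"
    assume ev1: "4 * real L * (ln (real (T m)) / real (T m)) < c / 4"
      and ev2: "4 * ln (real L) / c \<le> real (n m)" and ev3: "2 \<le> T m" and ev4: "1 \<le> n m"
    have t: "2 \<le> t" and N: "1 \<le> N" using ev3 ev4 by (simp_all add: t_def N_def)
    have "4 * real L * ln t \<le> c / 4 * t" using ev1 t by (simp add: t_def field_simps)
    hence l1: "N * (4 * real L * ln t) \<le> N * (c / 4 * t)" using N by (intro mult_left_mono) auto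
    have "ln (real L) \<le> c / 4 * N" using ev2 c by (simp add: N_def field_simps)
    hence l2: "t * ln (real L) \<le> t * (c / 4 * N)" using t by (intro mult_left_mono) auto
    have "ln (t + 1) \<le> ln (t\<^sup>2)"
    proof -
      have "t + 1 \<le> t * 2" using t by simp
      also have "\<dots> \<le> t * t" using t by (intro mult_left_mono) auto
      finally show ?thesis using t by (simp add: power2_eq_square)
    qed
    also have "\<dots> = 2 * ln t" using t by (simp add: ln_realpow)
    finally have "2 * real L * N * ln (t + 1) \<le> 2 * real L * N * (2 * ln t)"
      using N by (intro mult_left_mono) auto
    with l1 have l3: "2 * real L * N * ln (t + 1) \<le> c / 4 * N * t" by (simp add: algebra_simps)
    have l4: "c / 2 * t \<le> c / 2 * t * N" using c t N by simp
    have "real L ^ T m = exp (t * ln (real L))"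
      using L by (simp add: t_def exp_of_nat_mult)
    moreover have "(real (T m + 1) ^ 2) ^ (L * n m) = exp (2 * real L * N * ln (t + 1))"
    proof -
      have "(real (T m + 1) ^ 2) ^ (L * n m) = exp (ln (t + 1)) ^ (2 * (L * n m))"
        using t by (simp add: t_def power_mult add.commute)
      also have "\<dots> = exp (real (2 * (L * n m)) * ln (t + 1))" by (rule exp_of_nat_mult[symmetric])
      finally show ?thesis by (simp add: N_def mult_ac)
    qed
    ultimately have "real L ^ T m * (real (T m + 1) ^ 2) ^ (L * n m) * exp (- (c * real (n m) * real (T m)))
        = exp (t * ln (real L) + 2 * real L * N * ln (t + 1) - c * N * t)"
      by (simp add: exp_add exp_diff exp_minus t_def N_def divide_inverse)
    also have "\<dots> \<le> exp (- (c / 2 * t))"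
      using l2 l3 l4 by (simp add: algebra_simps)
    finally show "real L ^ T m * (real (T m + 1) ^ 2) ^ (L * n m) *
      exp (- (c * real (n m) * real (T m))) \<le> exp (- (c / 2 * real (T m)))" by (simp add: t_def)
  qed
  show "(\<lambda>m. exp (- (c / 2 * real (T m)))) \<longlonglongrightarrow> 0"
    using T_real c
    by (intro filterlim_compose[OF exp_at_bot] filterlim_compose[OF filterlim_uminus_at_bot_at_top]
        filterlim_tendsto_pos_mult_at_top[OF tendsto_const]) auto
qed (use L in \<open>auto intro!: always_eventually\<close>)

theorem theorem4:
  fixes nL :: nat
    and n T :: "nat \<Rightarrow> nat"
    and \<rho> :: "nat \<Rightarrow> nat \<Rightarrow> real"
    and A :: "nat \<Rightarrow> nat \<Rightarrow> nat \<Rightarrow> real"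
    and M :: "nat \<Rightarrow> 'a measure"
    and zs zhat :: "nat \<Rightarrow> nat \<Rightarrow> 'a \<Rightarrow> nat"
    and G :: "nat \<Rightarrow> nat \<Rightarrow> nat \<Rightarrow> 'a \<Rightarrow> bool"
    and c_min c_max d v \<delta> :: real
  assumes model:
      "\<And>m. asymmetric_hub_model (M m) nL (n m) (T m) (\<rho> m) (A m) (zs m) (G m)"
    and n_lim: "filterlim n at_top sequentially"
    and T_lim: "filterlim T at_top sequentially"
    and c_min_pos: "c_min > 0" and c_max_pos: "c_max > 0"
    and rho_min: "\<And>m. Min (\<rho> m ` {1..nL}) = c_min / real nL"
    and rho_max: "\<And>m. Max (\<rho> m ` {1..nL}) = c_max / real nL"
    and d_range: "d \<in> {0<..1}" and v_range: "v \<in> {0<..1}"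
    and separation:
      "\<And>m i. i \<in> {1..nL} \<Longrightarrow>
         \<exists>V \<subseteq> {1..n m}. real (card V) \<ge> v * real (n m) / real nL \<and>
           (\<forall>j\<in>V. \<forall>i'\<in>{1..nL}. i' \<noteq> i \<longrightarrow> A m i j - A m i' j \<ge> d)"
    and delta_pos: "\<delta> > 0"
    and bounded_away:
      "\<And>m i i'. i \<in> {1..nL} \<Longrightarrow> i' \<in> {1..nL} \<Longrightarrow> i \<noteq> i' \<Longrightarrow> A m i i' \<le> 1 - \<delta>"
    and zhat_measurable:
      "\<And>m t. t \<in> {1..T m} \<Longrightarrow> zhat m t \<in> measurable (M m) (count_space UNIV)"
    and zhat_maximizer:
      "\<And>m. AE \<omega> in M m.
         profile_mle nL (n m) (T m) (\<lambda>t j. G m t j \<omega>) (\<lambda>t. zhat m t \<omega>)"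
  shows "small_o_p_1 M
    (\<lambda>m \<omega>. real (mislabeled (T m) (\<lambda>t. zs m t \<omega>) (\<lambda>t. zhat m t \<omega>)) / real (T m))"
  unfolding small_o_p_1_def
proof (intro allI impI)
  fix \<epsilon> :: real assume \<epsilon>: "\<epsilon> > 0"
  have nL: "0 < nL"
    using asymmetric_hub_model.rho_sum[OF model[of 0]] by (cases "nL = 0") auto
  \<comment> \<open>The product c_min / nL * \<delta> bounds every \<rho> k (1 - A k i) with i
    different from k from below, and \<beta> is half of it. The minimum \<eta> meets both upper
    bounds required of it, and c collects the factors of n T in the exponent.\<close>
  define \<beta> where "\<beta> = c_min / real nL * \<delta> / 2"
  define \<eta> where "\<eta> = min \<epsilon> \<beta>"
  define c where "c = \<eta> * (v * d\<^sup>2 / real nL) / 16"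
  have \<beta>: "0 < \<beta>" using c_min_pos nL delta_pos by (simp add: \<beta>_def)
  have \<eta>: "0 < \<eta>" using \<beta> \<epsilon> by (simp add: \<eta>_def)
  have c: "0 < c" using \<eta> v_range d_range nL by (simp add: c_def)
  have rho_ge: "c_min / real nL \<le> \<rho> m k" if "k \<in> {1..nL}" for m k
    unfolding rho_min[of m, symmetric] using that by (intro Min_le) auto
  have rho_pos: "0 < \<rho> m k" if "k \<in> {1..nL}" for m k
    using c_min_pos nL by (intro less_le_trans[OF _ rho_ge[OF that]]) simp
  have beta_le: "2 * \<beta> \<le> \<rho> m k * (1 - A m k i)"
    if "k \<in> {1..nL}" "i \<in> {1..nL}" "k \<noteq> i" for m k i
  proof -
    have "c_min / real nL * \<delta> \<le> \<rho> m k * (1 - A m k i)"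
      using rho_ge[OF that(1), of m] rho_pos[OF that(1), of m] bounded_away[OF that, of m] delta_pos
      by (intro mult_mono) auto
    thus ?thesis by (simp add: \<beta>_def)
  qed
  \<comment> \<open>Only the nodes of the separating set of \<open>k\<close> are counted; each
    contributes at least d^2. The resulting separation is linear in n, so the gap is of order n
    T.\<close>
  have sep: "v * d\<^sup>2 / real nL * real (n m) \<le> (\<Sum>j\<in>{1..n m}. (A m k j - A m k' j)\<^sup>2)"
    if k: "k \<in> {1..nL}" and k': "k' \<in> {1..nL}" and ne: "k \<noteq> k'" for m k k'
  proof -
    obtain V where V: "V \<subseteq> {1..n m}" "v * real (n m) / real nL \<le> real (card V)"
      and ge: "\<And>j i'. j \<in> V \<Longrightarrow> i' \<in> {1..nL} \<Longrightarrow> i' \<noteq> k \<Longrightarrow> d \<le> A m k j - A m i' j"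
      using separation[OF k, of m] by blast
    have "v * d\<^sup>2 / real nL * real (n m) = v * real (n m) / real nL * d\<^sup>2" by simp
    also have "\<dots> \<le> real (card V) * d\<^sup>2" using V by (intro mult_right_mono) auto
    also have "\<dots> = (\<Sum>j\<in>V. d\<^sup>2)" by simp
    also have "\<dots> \<le> (\<Sum>j\<in>V. (A m k j - A m k' j)\<^sup>2)"
      using ge k' ne d_range by (intro sum_mono power_mono) auto
    also have "\<dots> \<le> (\<Sum>j\<in>{1..n m}. (A m k j - A m k' j)\<^sup>2)"
      using V by (intro sum_mono2) auto
    finally show ?thesis .
  qed
  define b where "b m = real nL ^ 2 * exp (- 2 * \<beta>\<^sup>2 * real (T m))
      + real nL ^ T m * (real (T m + 1) ^ 2) ^ (nL * n m) * exp (- (c * real (n m) * real (T m)))" for m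
  show "(\<lambda>m. \<P>(\<omega> in M m. \<bar>real (mislabeled (T m) (\<lambda>t. zs m t \<omega>) (\<lambda>t. zhat m t \<omega>)) / real (T m)\<bar> > \<epsilon>))
    \<longlonglongrightarrow> 0"
  proof (rule tendsto_sandwich[where f = "\<lambda>_. 0"])
    have "\<forall>\<^sub>F m in sequentially. 1 \<le> T m" using T_lim by (simp add: filterlim_at_top)
    thus "\<forall>\<^sub>F m in sequentially.
      \<P>(\<omega> in M m. \<bar>real (mislabeled (T m) (\<lambda>t. zs m t \<omega>) (\<lambda>t. zhat m t \<omega>)) / real (T m)\<bar> > \<epsilon>) \<le> b m"
    proof eventually_elim
      fix m assume T: "1 \<le> T m"
      have "\<P>(\<omega> in M m. real (mislabeled (T m) (\<lambda>t. zs m t \<omega>) (\<lambda>t. zhat m t \<omega>)) / real (T m) > \<epsilon>)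
        \<le> real nL ^ 2 * exp (- 2 * \<beta>\<^sup>2 * real (T m))
          + real nL ^ T m * (real (T m + 1) ^ 2) ^ (nL * n m)
            * exp (- (\<eta> * real (T m) * (v * d\<^sup>2 / real nL * real (n m)) / 16))"
        using T \<beta> v_range
        by (intro asymmetric_hub_model.prob_mislabeled_le[OF model] rho_pos sep beta_le zhat_maximizer)
          (auto simp: \<eta>_def)
      also have "\<dots> = b m" by (simp add: b_def c_def mult_ac)
      finally show "\<P>(\<omega> in M m. \<bar>real (mislabeled (T m) (\<lambda>t. zs m t \<omega>) (\<lambda>t. zhat m t \<omega>)) / real (T m)\<bar> > \<epsilon>)
          \<le> b m" by simp
    qed
    have "filterlim (\<lambda>m. 2 * \<beta>\<^sup>2 * real (T m)) at_top sequentially"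
      using \<beta> filterlim_compose[OF filterlim_real_sequentially T_lim]
      by (intro filterlim_tendsto_pos_mult_at_top[OF tendsto_const]) auto
    hence "(\<lambda>m. exp (- (2 * \<beta>\<^sup>2 * real (T m)))) \<longlonglongrightarrow> 0"
      by (intro filterlim_compose[OF exp_at_bot] filterlim_compose[OF filterlim_uminus_at_bot_at_top])
    hence "(\<lambda>m. real nL ^ 2 * exp (- 2 * \<beta>\<^sup>2 * real (T m))) \<longlonglongrightarrow> 0"
      by (intro tendsto_mult_right_zero) simp
    from tendsto_add[OF this union_bound_tendsto_0[OF n_lim T_lim nL c]]
    show "b \<longlonglongrightarrow> 0" by (simp add: b_def[abs_def])
  qed auto
qed

end
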